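(* Let $a\in\mathbb{R}$, $p>1$ real, and $\mathfrak{S}=\{x\in\mathbb{C}: -1\le \operatorname{Im}(x)\le 0\}$. Let $F$ be a complex function analytic on an open set containing $\{a\,x(x+i): x\in\mathfrak{S}\}$ such that $F(a\,x(x+i))=o\!\left(e^{\pi|x|}/|x|\right)$ uniformly for $x\in\mathfrak{S}$ as $\operatorname{Re}(x)\to\pm\infty$. Assume that the integrand below has no pole on the real axis (automatic if $p$ is not an integer). Then $$\int_{-\infty}^{\infty}\frac{F(a\,x(x+i))}{\sinh(\pi p(2x+i))}\,dx=\frac{i}{2p}\sum_{n=\lfloor -p\rfloor}^{\lfloor p-1\rfloor}(-1)^n\,F\!\left(-\frac{a\,\big((n+1)^2-p^2\big)}{4p^2}\right).$$
   Context: The integral over the real line is understood as $\lim_{R\to\infty}\int_{-R}^{R}$ (removable singularities of the integrand being filled in); $\lfloor y\rfloor$ is the greatest integer not exceeding $y$. *)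

theory Defs
  imports "HOL-Complex_Analysis.Complex_Analysis" "HOL-Library.Landau_Symbols"
begin

definition strip :: "complex set" where
  "strip = {x. -1 \<le> Im x \<and> Im x \<le> 0}"

text \<open>The limit \<open>Re x \<longrightarrow> \<plusminus>\<infinity>\<close> inside the strip: a property holds eventually for this filter iff
  there is some \<open>R\<close> such that it holds for all \<open>x\<close> in the strip with \<open>\<bar>Re x\<bar> \<ge> R\<close>.
  Asymptotics along it are therefore uniform in \<open>Im x\<close>.\<close>
definition strip_ends :: "complex filter" where
  "strip_ends = inf (filtercomap (\<lambda>x. \<bar>Re x\<bar>) at_top) (principal strip)"

definition sinh_integrand :: "(complex \<Rightarrow> complex) \<Rightarrow> real \<Rightarrow> real \<Rightarrow> complex \<Rightarrow> complex" where
  "sinh_integrand F a p x =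
     F (of_real a * x * (x + \<i>)) / sinh (of_real pi * of_real p * (2 * x + \<i>))"

text \<open>Integrability is demanded explicitly, since \<open>integral\<close> is \<open>0\<close> on non-integrable functions.\<close>
definition has_symmetric_integral :: "(real \<Rightarrow> complex) \<Rightarrow> complex \<Rightarrow> bool" where
  "has_symmetric_integral g I \<longleftrightarrow>
     (\<forall>R. g integrable_on {-R..R}) \<and> ((\<lambda>R. integral {-R..R} g) \<longlongrightarrow> I) at_top"

end

theory Submission imports Defs "HOL-Real_Asymp.Real_Asymp" begin

text \<open>
  Write \<open>f x = G x / S x\<close> for the integrand, with \<open>G x = F (a x (x + \<i>))\<close> and
  \<open>S x = sinh (\<pi> p (2 x + \<i>))\<close>. The argument of \<open>F\<close> is unchanged by the half turn
  \<open>x \<mapsto> -\<i> - x\<close> about the centre \<open>-\<i>/2\<close> of the strip, whereas \<open>S\<close> changes sign, so \<open>f\<close> is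
  odd under this half turn. The turn exchanges the two edges of the strip, hence the boundary
  integral of \<open>f\<close> over the rectangle \<open>[-R, R] \<times> [-1, 0]\<close> is \<open>-2\<close> times its integral over \<open>[-R, R]\<close>,
  up to the two vertical sides. By the residue theorem the integral over \<open>[-R, R]\<close> is
  therefore \<open>-\<pi> \<i>\<close> times the sum of the residues in the open strip, with an error bounded by the
  size of \<open>f\<close> on the vertical sides (\<open>integral_odd_about_strip_centre\<close>). There \<open>f\<close> is
  \<open>O(exp (\<pi> R - 2 \<pi> p R))\<close>, which tends to \<open>0\<close>.

  The zeros of \<open>S\<close> are the simple zeros \<open>\<i> (k / p - 1) / 2\<close> for integer \<open>k\<close>; those with
  \<open>\<bar>k\<bar> < p\<close> lie inside the strip, and the residue of \<open>f\<close> there is \<open>(-1)\<^sup>k / (2 \<pi> p)\<close> times the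
  value of \<open>F\<close> at \<open>-a (k\<^sup>2 - p\<^sup>2) / (4 p\<^sup>2)\<close>. With \<open>k = n + 1\<close> this is the stated sum, except that
  for integer \<open>p\<close> the sum also contains \<open>k = p\<close>, whose term is a multiple of \<open>F 0\<close>. In that case
  \<open>S\<close> vanishes at \<open>0\<close>, and since \<open>f\<close> has no pole there, \<open>F 0 = 0\<close>.
\<close>

section \<open>Residues and integrals over rectangles\<close>

text \<open>The set on which \<open>f\<close> is analytic, together with \<open>P\<close>, is open, so it contains a uniform
  neighbourhood of the compact rectangle. That neighbourhood is convex, hence connected, and
  the residue theorem applies on it; this is why analyticity need only be known pointwise on the
  closed rectangle.\<close>
lemma contour_integral_rectpath_residues:
  assumes less: "Re a < Re b" "Im a < Im b"
    and P: "finite P" "P \<subseteq> box a b"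
    and ana: "\<And>z. z \<in> cbox a b - P \<Longrightarrow> f analytic_on {z}"
    and iso: "\<And>z. z \<in> P \<Longrightarrow> isolated_singularity_at f z"
  shows "contour_integral (rectpath a b) f = 2 * pi * \<i> * (\<Sum>z\<in>P. residue f z)"
proof -
  define W where "W = {z. f analytic_on {z}} \<union> P"
  have nhd: "\<exists>e>0. ball z e \<subseteq> W" if "z \<in> W" for z
  proof (cases "z \<in> P")
    case True
    then obtain r where "r > 0" "f analytic_on ball z r - {z}"
      using iso unfolding isolated_singularity_at_def by blast
    then have "ball z r \<subseteq> W"
      using True analytic_on_analytic_at[of f "ball z r - {z}"] by (auto simp: W_def)
    with \<open>r > 0\<close> show ?thesis by blast
  next
    case False
    then have "f analytic_on {z}" using that by (simp add: W_def)
    then obtain e where "e > 0" "f holomorphic_on ball z e"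
      by (auto simp: analytic_at_ball)
    then have "ball z e \<subseteq> W"
      using holomorphic_on_imp_analytic_at[of f "ball z e"] by (auto simp: W_def)
    with \<open>e > 0\<close> show ?thesis by blast
  qed
  then have "open W" by (auto simp: open_contains_ball)
  moreover have "cbox a b \<subseteq> W" using ana by (auto simp: W_def)
  ultimately obtain e where e: "e > 0" "(\<Union>x\<in>cbox a b. ball x e) \<subseteq> W"
    using compact_subset_open_imp_ball_epsilon_subset[of "cbox a b" W] by auto
  define S where "S = (\<Union>x\<in>cbox a b. \<Union>y\<in>ball 0 e. {x + y})"
  have S_eq: "S = (\<Union>x\<in>cbox a b. ball x e)"
  proof -
    have "(\<Union>y\<in>ball 0 e. {x + y}) = ball x e" for x :: complex
      by (auto simp: dist_norm norm_minus_commute image_iff intro!: bexI[of _ "_ - x"])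
    then show ?thesis by (simp add: S_def)
  qed
  have "convex S" unfolding S_def by (intro convex_sums) auto
  then have "connected S" by (rule convex_connected)
  have "open S" unfolding S_eq by auto
  have "cbox a b \<subseteq> S" unfolding S_eq using e(1) by auto
  have "f holomorphic_on S - P"
    using e(2) analytic_on_analytic_at[of f "S - P"]
    by (intro analytic_imp_holomorphic) (auto simp: S_eq W_def)
  moreover have "path_image (rectpath a b) \<subseteq> S - P"
    using P less \<open>cbox a b \<subseteq> S\<close> by (auto simp: path_image_rectpath_cbox_minus_box)
  moreover have "\<forall>z. z \<notin> S \<longrightarrow> winding_number (rectpath a b) z = 0"
    using \<open>cbox a b \<subseteq> S\<close> less by (auto intro!: winding_number_rectpath_outside)
  ultimately have "contour_integral (rectpath a b) f
      = 2 * pi * \<i> * (\<Sum>z\<in>P. winding_number (rectpath a b) z * residue f z)"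
    using \<open>open S\<close> \<open>connected S\<close> \<open>finite P\<close> by (intro Residue_theorem) auto
  also have "(\<Sum>z\<in>P. winding_number (rectpath a b) z * residue f z) = (\<Sum>z\<in>P. residue f z)"
    using P by (intro sum.cong) (auto simp: winding_number_rectpath)
  finally show ?thesis .
qed

lemma has_contour_integral_horizontal_iff:
  assumes "r < s"
  shows "(f has_contour_integral I) (linepath (Complex r y) (Complex s y)) \<longleftrightarrow>
         ((\<lambda>x. f (Complex x y)) has_integral I) {r..s}"
proof -
  have "(f has_contour_integral I) (linepath (Complex r y) (Complex s y)) \<longleftrightarrow>
        ((\<lambda>z. f (z + Complex 0 y)) has_contour_integral I) (linepath (Complex r 0) (Complex s 0))"
    unfolding has_contour_integral_linepath
    by (simp add: linepath_def algebra_simps complex_eq_iff scaleR_conv_of_real Complex_eq)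
  also have "\<dots> \<longleftrightarrow> ((\<lambda>x. f (of_real x + Complex 0 y)) has_integral I) {r..s}"
    using has_contour_integral_linepath_Reals_iff[of "Complex r 0" "Complex s 0" "\<lambda>z. f (z + Complex 0 y)" I] assms
    by (simp add: complex_is_Real_iff)
  also have "(\<lambda>x. f (of_real x + Complex 0 y)) = (\<lambda>x. f (Complex x y))"
    by (intro ext arg_cong[where f = f]) (simp add: complex_eq_iff)
  finally show ?thesis .
qed

text \<open>The half turn about \<open>-\<i>/2\<close> maps the lower edge of the rectangle to its upper edge and
  reverses the direction of the real axis; for odd \<open>h\<close> both horizontal edges of the positively
  oriented boundary then contribute minus the integral over \<open>[-R, R]\<close>. The two sides have
  length \<open>1\<close>, so dividing by \<open>2\<close> leaves the error \<open>B\<close>.\<close>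
lemma integral_odd_about_strip_centre:
  assumes odd: "\<And>z. h (-\<i> - z) = - h z" and "R > 0"
    and P: "finite P" "\<And>z. z \<in> P \<Longrightarrow> \<bar>Re z\<bar> < R \<and> -1 < Im z \<and> Im z < 0"
    and ana: "\<And>z. z \<in> strip \<Longrightarrow> z \<notin> P \<Longrightarrow> h analytic_on {z}"
    and iso: "\<And>z. z \<in> P \<Longrightarrow> isolated_singularity_at h z"
    and B: "\<And>z. z \<in> strip \<Longrightarrow> \<bar>Re z\<bar> = R \<Longrightarrow> norm (h z) \<le> B"
  shows "norm (integral {-R..R} (\<lambda>x. h (of_real x)) + pi * \<i> * (\<Sum>z\<in>P. residue h z)) \<le> B"
proof -
  define a where "a = Complex (-R) (-1)"
  define b where "b = Complex R (-1)"
  define c where "c = Complex R 0"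
  define d where "d = Complex (-R) 0"
  define I where "I = integral {-R..R} (\<lambda>x. h (of_real x))"
  have box: "cbox a c \<subseteq> strip" "P \<subseteq> box a c"
    using P by (force simp: a_def c_def strip_def in_cbox_complex_iff in_box_complex_iff)+
  have image: "path_image (rectpath a c) = cbox a c - box a c"
    using \<open>R > 0\<close> by (intro path_image_rectpath_cbox_minus_box) (auto simp: a_def c_def)
  have rect: "rectpath a c = linepath a b +++ linepath b c +++ linepath c d +++ linepath d a"
    by (simp add: rectpath_def Let_def a_def b_def c_def d_def)
  have cont: "continuous_on (path_image (rectpath a c)) h"
    using box unfolding image
    by (intro holomorphic_on_imp_continuous_on analytic_imp_holomorphic)
       (subst analytic_on_analytic_at, auto intro: ana)
  have sub: "closed_segment a b \<subseteq> path_image (rectpath a c)"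
    "closed_segment b c \<subseteq> path_image (rectpath a c)"
    "closed_segment c d \<subseteq> path_image (rectpath a c)"
    "closed_segment d a \<subseteq> path_image (rectpath a c)"
    by (simp_all add: rect path_image_join) auto
  have int: "h contour_integrable_on linepath a b" "h contour_integrable_on linepath b c"
    "h contour_integrable_on linepath c d" "h contour_integrable_on linepath d a"
    using continuous_on_subset[OF cont] sub by (auto intro!: contour_integrable_continuous_linepath)
  have top: "(h has_contour_integral - I) (linepath c d)"
  proof -
    have "h contour_integrable_on linepath d c"
      using int(3) contour_integrable_reversepath_eq[of "linepath d c" h] by simp
    then have "(h has_contour_integral contour_integral (linepath d c) h) (linepath d c)"
      by (rule has_contour_integral_integral)
    moreover from this have "((\<lambda>x. h (Complex x 0)) has_integral contour_integral (linepath d c) h) {-R..R}"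
      using \<open>R > 0\<close> unfolding c_def d_def by (subst (asm) has_contour_integral_horizontal_iff) auto
    then have "contour_integral (linepath d c) h = I"
      unfolding I_def by (simp add: integral_unique complex_of_real_def)
    ultimately show ?thesis
      using has_contour_integral_reversepath[of "linepath d c" h I] by simp
  qed
  have bot: "(h has_contour_integral - I) (linepath a b)"
  proof -
    have "((\<lambda>x. h (Complex x (-1))) has_integral contour_integral (linepath a b) h) {-R..R}"
      using has_contour_integral_integral[OF int(1)] \<open>R > 0\<close>
      unfolding a_def b_def by (subst (asm) has_contour_integral_horizontal_iff) auto
    also have "(\<lambda>x. h (Complex x (-1))) = (\<lambda>x. - h (of_real (- x)))"
    proof
      fix x
      have "Complex x (-1) = -\<i> - of_real (- x)" by (simp add: complex_eq_iff)
      then show "h (Complex x (-1)) = - h (of_real (- x))" by (simp only: odd)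
    qed
    finally have "contour_integral (linepath a b) h = integral {-R..R} (\<lambda>x. - h (of_real (- x)))"
      by (rule integral_unique[symmetric])
    also have "\<dots> = - I"
      unfolding I_def
      using Henstock_Kurzweil_Integration.integral_reflect_real[of R "-R" "\<lambda>x. h (of_real x)"]
      by simp
    finally show ?thesis using has_contour_integral_integral[OF int(1)] by simp
  qed
  have side: "norm (contour_integral (linepath u v) h) \<le> B"
    if "h contour_integrable_on linepath u v" "norm (v - u) = 1"
      "\<And>z. z \<in> closed_segment u v \<Longrightarrow> z \<in> strip \<and> \<bar>Re z\<bar> = R" for u v
  proof -
    have "norm (h u) \<le> B" using that(3)[of u] B by auto
    then have "B \<ge> 0" using norm_ge_zero order.trans by blast
    then show ?thesis
      using contour_integral_bound_linepath[OF that(1) _ B] that by simp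
  qed
  have right: "norm (contour_integral (linepath b c) h) \<le> B"
    by (rule side[OF int(2)])
       (use \<open>R > 0\<close> in \<open>auto simp: b_def c_def strip_def closed_segment_same_Re cmod_def closed_segment_eq_real_ivl\<close>)
  have left: "norm (contour_integral (linepath d a) h) \<le> B"
    by (rule side[OF int(4)])
       (use \<open>R > 0\<close> in \<open>auto simp: a_def d_def strip_def closed_segment_same_Re cmod_def closed_segment_eq_real_ivl\<close>)
  have "2 * pi * \<i> * (\<Sum>z\<in>P. residue h z) = contour_integral (rectpath a c) h"
    using box P(1) iso ana \<open>R > 0\<close>
    by (intro contour_integral_rectpath_residues[symmetric]) (auto simp: a_def c_def)
  also have "\<dots> = contour_integral (linepath a b) h + (contour_integral (linepath b c) h
       + (contour_integral (linepath c d) h + contour_integral (linepath d a) h))"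
    using int by (simp add: rect)
  also have "\<dots> = - 2 * I + (contour_integral (linepath b c) h + contour_integral (linepath d a) h)"
    using contour_integral_unique[OF top] contour_integral_unique[OF bot] by simp
  finally have "I + pi * \<i> * (\<Sum>z\<in>P. residue h z)
      = (contour_integral (linepath b c) h + contour_integral (linepath d a) h) / 2"
    by (simp add: field_simps)
  also have "norm \<dots> \<le> (B + B) / 2"
    using norm_triangle_mono[OF right left] by (simp add: norm_divide)
  finally show ?thesis by (simp add: I_def)
qed

section \<open>Quotients with a simple zero in the denominator\<close>

lemma eventually_nonzero_at_simple_zero:
  fixes g :: "complex \<Rightarrow> complex"
  assumes "(g has_field_derivative g') (at z)" "g z = 0" "g' \<noteq> 0"
  shows "eventually (\<lambda>w. g w \<noteq> 0) (at z)"
proof -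
  have "((\<lambda>w. g w / (w - z)) \<longlongrightarrow> g') (at z)"
    using assms by (simp add: has_field_derivative_iff)
  then have "eventually (\<lambda>w. g w / (w - z) \<noteq> 0) (at z)"
    using assms(3) by (rule tendsto_imp_eventually_ne)
  then show ?thesis by (rule eventually_mono) auto
qed

text \<open>Unlike \<open>residue_simple_pole_deriv\<close>, this covers a vanishing numerator, where the
  singularity is removable. The residue is obtained as the limit of \<open>(w - z) f w / g w\<close>, which
  does not depend on the kind of singularity.\<close>
lemma residue_divide_simple_zero:
  assumes "isolated_singularity_at (\<lambda>w. f w / g w) z" "isCont f z"
    and g: "(g has_field_derivative g') (at z)" "g z = 0" "g' \<noteq> 0"
  shows "residue (\<lambda>w. f w / g w) z = f z / g'"
proof -
  obtain r where "r > 0" "(\<lambda>w. f w / g w) analytic_on ball z r - {z}"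
    using assms(1) unfolding isolated_singularity_at_def by blast
  moreover have "((\<lambda>w. f w / (g w / (w - z))) \<longlongrightarrow> f z / g') (at z)"
    using assms by (intro tendsto_divide) (simp_all add: isCont_def has_field_derivative_iff)
  then have "((\<lambda>w. f w / g w * (w - z)) \<longlongrightarrow> f z / g') (at z)"
    by simp
  ultimately show ?thesis
    by (intro residue_simple'[of "ball z r"]) (auto intro: analytic_imp_holomorphic)
qed

lemma is_pole_divide_simple_zero:
  fixes f g :: "complex \<Rightarrow> complex"
  assumes "isCont f z" "f z \<noteq> 0" and g: "(g has_field_derivative g') (at z)" "g z = 0" "g' \<noteq> 0"
  shows "is_pole (\<lambda>w. f w / g w) z"
proof (rule is_pole_divide)
  have "(g \<longlongrightarrow> 0) (at z)" using DERIV_isCont[OF g(1)] g(2) by (simp add: isCont_def)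
  then show "filterlim g (at 0) (at z)"
    using eventually_nonzero_at_simple_zero[OF g] by (auto simp: filterlim_at)
qed (use assms in auto)

section \<open>Auxiliary facts on the hyperbolic sine and on removed singularities\<close>

lemma norm_sinh_ge: "\<bar>sinh (Re w)\<bar> \<le> norm (sinh w)"
proof -
  have "2 * \<bar>sinh (Re w)\<bar> = \<bar>norm (exp w) - norm (exp (- w))\<bar>"
    by (simp add: sinh_field_def)
  also have "\<dots> \<le> norm (exp w - exp (- w))" by (rule norm_triangle_ineq3)
  also have "\<dots> = 2 * norm (sinh w)" by (simp add: sinh_field_def norm_divide)
  finally show ?thesis by simp
qed

lemma remove_sings_uminus: "remove_sings (\<lambda>w. - f w) z = - remove_sings f z"
proof (cases "\<exists>c. f \<midarrow>z\<rightarrow> c")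
  case True
  then obtain c where c: "f \<midarrow>z\<rightarrow> c" by blast
  then show ?thesis using remove_sings_eqI[OF c] remove_sings_eqI[OF tendsto_minus[OF c]] by simp
next
  case False
  moreover have "\<not> (\<exists>c. (\<lambda>w. - f w) \<midarrow>z\<rightarrow> c)"
    using False tendsto_minus_cancel_left by blast
  ultimately show ?thesis by (simp add: remove_sings_def)
qed

lemma sinh_zero_iff_int:
  fixes w :: complex
  shows "sinh w = 0 \<longleftrightarrow> (\<exists>k::int. w = \<i> * of_real (of_int k * pi))"
proof -
  have "sinh w = 0 \<longleftrightarrow> (\<exists>k::int. \<i> * w = of_real (of_int k * pi))"
    by (simp add: sinh_conv_sin sin_eq_0)
  also have "\<dots> \<longleftrightarrow> (\<exists>k::int. w = - \<i> * of_real (of_int k * pi))"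
    by (intro ex_cong1) (auto simp: complex_eq_iff)
  also have "\<dots> \<longleftrightarrow> (\<exists>k::int. w = \<i> * of_real (of_int k * pi))"
    (is "(\<exists>k. ?L k) = (\<exists>k. ?R k)")
  proof -
    have "?L k = ?R (- k)" for k by simp
    then show ?thesis by (metis minus_minus)
  qed
  finally show ?thesis .
qed

section \<open>The integral formula\<close>

theorem mainTheorem4:
  fixes a p :: real and F :: "complex \<Rightarrow> complex" and U :: "complex set"
  assumes "p > 1"
    and "open U"
    and "(\<lambda>x. of_real a * x * (x + \<i>)) ` strip \<subseteq> U"
    and "F analytic_on U"
    and "(\<lambda>x. F (of_real a * x * (x + \<i>)))
           \<in> o[strip_ends](\<lambda>x. of_real (exp (pi * norm x) / norm x))"
    and "\<And>x::real. \<not> is_pole (sinh_integrand F a p) (of_real x)"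
  shows "has_symmetric_integral
           (\<lambda>x. remove_sings (sinh_integrand F a p) (of_real x))
           (\<i> / (2 * of_real p) *
              (\<Sum>n = \<lfloor>- p\<rfloor>..\<lfloor>p - 1\<rfloor>.
                 (-1) powi n *
                 F (of_real (- (a * ((of_int n + 1)\<^sup>2 - p\<^sup>2) / (4 * p\<^sup>2))))))"
proof -
  define G where "G = (\<lambda>x. F (of_real a * x * (x + \<i>)))"
  define S where "S = (\<lambda>x. sinh (of_real pi * of_real p * (2 * x + \<i>)))"
  define f where "f = sinh_integrand F a p"
  define h where "h = remove_sings f"
  define pt where "pt = (\<lambda>k::int. \<i> * of_real ((of_int k / p - 1) / 2))"
  define K where "K = {k::int. \<bar>of_int k\<bar> < p}"
  define c where "c = (\<lambda>k::int. (-1) powi k * F (of_real (- (a * ((of_int k)\<^sup>2 - p\<^sup>2) / (4 * p\<^sup>2)))))"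
  have p: "p > 0" using assms(1) by simp
  have f_eq: "f = (\<lambda>x. G x / S x)"
    by (simp add: f_def G_def S_def sinh_integrand_def fun_eq_iff)

  have G_ana: "G analytic_on {z}" if "z \<in> strip" for z
  proof -
    have "F analytic_on {of_real a * z * (z + \<i>)}"
      using assms(3,4) that analytic_on_subset by blast
    then show ?thesis
      unfolding G_def
      by (intro analytic_on_compose_gen[of "\<lambda>x. of_real a * x * (x + \<i>)" "{z}" F, unfolded o_def])
         (auto intro!: analytic_intros)
  qed
  have S_deriv: "(S has_field_derivative 2 * pi * p * cosh (pi * p * (2 * z + \<i>))) (at z)" for z
    unfolding S_def by (auto intro!: derivative_eq_intros)
  have S_ana: "S analytic_on A" for A unfolding S_def by (intro analytic_intros)

  have Re_pt: "Re (pt k) = 0" and Im_pt: "Im (pt k) = (of_int k / p - 1) / 2" for k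
    by (simp_all add: pt_def)
  have S_zero_iff: "S z = 0 \<longleftrightarrow> (\<exists>k. z = pt k)" for z
  proof -
    have "pi * p * (2 * z + \<i>) - \<i> * of_real (of_int k * pi) = 2 * pi * p * (z - pt k)" for k
      using p by (simp add: pt_def field_simps)
    then have "pi * p * (2 * z + \<i>) = \<i> * of_real (of_int k * pi) \<longleftrightarrow> z = pt k" for k
      using p by (metis mult_eq_0_iff of_real_eq_0_iff pi_neq_zero right_minus_eq zero_neq_numeral less_irrefl)
    then show ?thesis unfolding S_def sinh_zero_iff_int by simp
  qed
  have S_deriv_pt: "(S has_field_derivative 2 * pi * p * (-1) powi k) (at (pt k))" for k
  proof -
    have "pi * p * (2 * pt k + \<i>) = \<i> * of_real (pi * of_int k)"
      using p by (simp add: pt_def complex_eq_iff field_simps)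
    then have "cosh (pi * p * (2 * pt k + \<i>)) = cosh (\<i> * of_real (pi * of_int k))"
      by (simp only:)
    also have "\<dots> = cos (of_real (pi * of_int k))"
      by (simp only: cos_conv_cosh)
    also have "\<dots> = (-1) powi k"
      by (cases k rule: int_cases2)
         (simp_all add: cos_of_real power_int_minus_left power_int_def minus_one_power_iff del: of_real_mult)
    finally show ?thesis using S_deriv[of "pt k"] by simp
  qed

  have f_odd: "f (-\<i> - z) = - f z" for z
  proof -
    have "G (-\<i> - z) = G z" by (simp add: G_def algebra_simps)
    moreover have "S (-\<i> - z) = - S z"
      unfolding S_def sinh_minus[symmetric] by (simp add: algebra_simps)
    ultimately show ?thesis by (simp add: f_eq)
  qed
  have reflect: "filtermap (\<lambda>z. -\<i> - z) (at z) = at (-\<i> - z)" for z :: complex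
  proof -
    have "filtermap (\<lambda>z. -\<i> - z) (at z) = filtermap (\<lambda>w. w - \<i>) (filtermap uminus (at z))"
      by (auto simp: filtermap_filtermap algebra_simps intro!: arg_cong2[where f = filtermap])
    also have "\<dots> = at (-\<i> - z)"
      by (simp add: filtermap_at_minus filtermap_at_shift minus_diff_commute[of z])
    finally show ?thesis .
  qed
  have h_odd: "h (-\<i> - z) = - h z" for z
    using remove_sings_compose[OF reflect, of f z] remove_sings_uminus[of f z]
    by (simp add: h_def o_def f_odd)

  have f_mero: "f meromorphic_on strip"
    unfolding f_eq
    by (intro meromorphic_on_divide analytic_on_imp_meromorphic_on S_ana)
       (subst analytic_on_analytic_at, use G_ana in auto)
  have f_iso: "isolated_singularity_at f z" if "z \<in> strip" for z
    using f_mero that by (auto simp: meromorphic_on_altdef)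

  have f_ana: "f analytic_on {z}" if "z \<in> strip" "S z \<noteq> 0" for z
    unfolding f_eq using that by (intro analytic_on_divide G_ana S_ana) auto
  have not_pole: "\<not> is_pole f z" if z: "z \<in> strip" "z \<notin> pt ` K" for z
  proof -
    have real: "\<not> is_pole f w" if "Im w = 0" for w
    proof -
      have "of_real (Re w) = w" using that by (simp add: complex_eq_iff)
      then show ?thesis using assms(6)[of "Re w"] by (simp add: f_def)
    qed
    consider "Im z = 0" | "Im z = -1" | "-1 < Im z" "Im z < 0"
      using z(1) by (force simp: strip_def)
    then show ?thesis
    proof cases
      case 1
      then show ?thesis by (rule real)
    next
      case 2
      \<comment> \<open>the half turn moves a pole on the lower edge to the real axis\<close>
      have "is_pole f (-\<i> - z)" if "is_pole f z"
      proof -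
        have "filterlim f at_infinity (filtermap (\<lambda>w. -\<i> - w) (at (-\<i> - z)))"
          using that unfolding reflect by (simp add: is_pole_def)
        then have "filterlim (\<lambda>w. - f w) at_infinity (at (-\<i> - z))"
          by (simp add: filterlim_filtermap f_odd)
        then show ?thesis
          by (simp add: is_pole_def filterlim_at_infinity_conv_norm_at_top)
      qed
      then show ?thesis using real[of "-\<i> - z"] 2 by auto
    next
      case 3
      have "S z \<noteq> 0"
      proof
        assume "S z = 0"
        then obtain k where k: "z = pt k" by (auto simp: S_zero_iff)
        then have "k \<in> K" using 3 p by (auto simp: Im_pt K_def field_simps abs_less_iff)
        with k z(2) show False by blast
      qed
      then show ?thesis using f_ana z(1) analytic_at_imp_no_pole by blast
    qed
  qed
  have h_ana: "h analytic_on {z}" if "z \<in> strip" "z \<notin> pt ` K" for z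
    unfolding h_def
  proof (rule nicely_meromorphic_on_imp_analytic_at)
    show "remove_sings f nicely_meromorphic_on strip"
      using f_mero by (rule remove_sings_nicely_meromorphic)
    show "\<not> is_pole (remove_sings f) z"
      using not_pole[OF that] f_iso[OF that(1)] by simp
  qed fact

  have pt_strip: "pt k \<in> strip" if "\<bar>of_int k\<bar> \<le> p" for k
    using that p by (auto simp: Im_pt strip_def field_simps)
  have G_pt: "G (pt k) = F (of_real (- (a * ((of_int k)\<^sup>2 - p\<^sup>2) / (4 * p\<^sup>2))))" for k
    unfolding G_def using p
    by (intro arg_cong[where f = F]) (simp add: pt_def complex_eq_iff field_simps power2_eq_square)

  have res: "residue h (pt k) = c k / (2 * pi * p)" if "k \<in> K" for k
  proof -
    have k: "pt k \<in> strip" using pt_strip that by (auto simp: K_def)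
    have "residue h (pt k) = residue f (pt k)"
      unfolding h_def using f_iso[OF k] by simp
    also have "\<dots> = G (pt k) / (2 * pi * p * (-1) powi k)"
      unfolding f_eq
    proof (rule residue_divide_simple_zero)
      show "isolated_singularity_at (\<lambda>w. G w / S w) (pt k)" using f_iso[OF k] by (simp add: f_eq)
      show "isCont G (pt k)" using G_ana[OF k] by (rule analytic_at_imp_isCont)
    qed (use S_deriv_pt p in \<open>auto simp: S_zero_iff\<close>)
    also have "\<dots> = c k / (2 * pi * p)"
      by (simp add: c_def G_pt power_int_minus_left)
    finally show ?thesis .
  qed
  have sum_eq: "(\<Sum>n = \<lfloor>- p\<rfloor>..\<lfloor>p - 1\<rfloor>. (-1) powi n *
                 F (of_real (- (a * ((of_int n + 1)\<^sup>2 - p\<^sup>2) / (4 * p\<^sup>2))))) = - (\<Sum>k\<in>K. c k)"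
  proof -
    have "(\<Sum>n = \<lfloor>- p\<rfloor>..\<lfloor>p - 1\<rfloor>. (-1) powi n *
            F (of_real (- (a * ((of_int n + 1)\<^sup>2 - p\<^sup>2) / (4 * p\<^sup>2)))))
        = (\<Sum>n = \<lfloor>- p\<rfloor>..\<lfloor>p - 1\<rfloor>. - c (n + 1))"
      by (intro sum.cong) (auto simp: c_def power_int_add)
    also have "\<dots> = (\<Sum>k\<in>{\<lfloor>- p\<rfloor> + 1..\<lfloor>p\<rfloor>}. - c k)"
      by (rule sum.reindex_bij_witness[of _ "\<lambda>k. k - 1" "\<lambda>n. n + 1"]) auto
    \<comment> \<open>the integers \<open>k\<close> with \<open>-p < k \<le> p\<close>: only \<open>k = p\<close>, if \<open>p\<close> is an integer, is outside \<open>K\<close>\<close>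
    also have "\<dots> = (\<Sum>k\<in>K. - c k)"
    proof (rule sum.mono_neutral_right)
      show "K \<subseteq> {\<lfloor>- p\<rfloor> + 1..\<lfloor>p\<rfloor>}"
        unfolding K_def by (auto simp: le_floor_iff; linarith)
      show "\<forall>k\<in>{\<lfloor>- p\<rfloor> + 1..\<lfloor>p\<rfloor>} - K. - c k = 0"
      proof
        fix k assume "k \<in> {\<lfloor>- p\<rfloor> + 1..\<lfloor>p\<rfloor>} - K"
        then have k: "of_int k = p" unfolding K_def by (auto simp: le_floor_iff; linarith)
        have "G (pt k) = 0"
        proof (rule ccontr)
          assume "G (pt k) \<noteq> 0"
          moreover have "isCont G (pt k)"
            using k p by (intro analytic_at_imp_isCont G_ana pt_strip) auto
          ultimately have "is_pole f (pt k)"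
            unfolding f_eq using p
            by (intro is_pole_divide_simple_zero[OF _ _ S_deriv_pt]) (auto simp: S_zero_iff)
          moreover have "pt k = 0" using k p by (simp add: complex_eq_iff Re_pt Im_pt)
          ultimately show False using assms(6)[of 0] by (simp add: f_def)
        qed
        then show "- c k = 0" by (simp add: c_def G_pt)
      qed
    qed auto
    finally show ?thesis by (simp add: sum_negf)
  qed
  obtain R0 where growth: "\<And>z. z \<in> strip \<Longrightarrow> \<bar>Re z\<bar> \<ge> R0 \<Longrightarrow> norm (G z) \<le> exp (pi * norm z) / norm z"
  proof -
    have "\<forall>\<^sub>F z in strip_ends. norm (G z) \<le> 1 * norm (complex_of_real (exp (pi * norm z) / norm z))"
      using assms(5) unfolding G_def by (rule landau_o.smallD) simp
    then show ?thesis
      by (auto simp: strip_ends_def eventually_inf_principal eventually_filtercomap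
            eventually_at_top_linorder norm_divide intro: that)
  qed
  define B where "B = (\<lambda>R. exp (pi * (R + 1)) / sinh (2 * pi * R))"
  \<comment> \<open>in the strip \<open>\<bar>z\<bar> \<le> R + 1\<close>, and \<open>sinh (2 \<pi> p R) \<ge> sinh (2 \<pi> R)\<close> because \<open>p > 1\<close>\<close>
  have bound: "norm (h z) \<le> B R" if "z \<in> strip" "\<bar>Re z\<bar> = R" "R \<ge> R0" "R \<ge> 1" for z R
  proof -
    have "S z \<noteq> 0" using that by (auto simp: S_zero_iff Re_pt)
    then have "norm (h z) = norm (G z) / norm (S z)"
      using f_ana that(1) by (simp add: h_def) (simp add: f_eq norm_divide)
    also have "\<dots> \<le> exp (pi * (R + 1)) / sinh (2 * pi * R)"
    proof (rule frac_le)
      have "norm z \<le> R + 1" "norm z \<ge> 1"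
        using cmod_le[of z] abs_Re_le_cmod[of z] that by (auto simp: strip_def)
      then have "exp (pi * norm z) / norm z \<le> exp (pi * (R + 1)) / 1"
        by (intro frac_le) auto
      then show "norm (G z) \<le> exp (pi * (R + 1))"
        using growth[of z] that by simp
      have "sinh (2 * pi * R) \<le> sinh (2 * pi * p * R)"
        using that assms(1) by (simp add: strict_mono_less_eq[OF sinh_real_strict_mono])
      also have "\<dots> = \<bar>sinh (2 * pi * p * Re z)\<bar>"
      proof -
        have "0 \<le> sinh (2 * pi * p * R)" using that(4) p by simp
        moreover have "Re z = R \<or> Re z = - R" using that(2) by linarith
        ultimately show ?thesis
          by (metis abs_minus_cancel abs_of_nonneg mult_minus_right sinh_minus)
      qed
      also have "\<dots> \<le> norm (S z)"
        unfolding S_def using norm_sinh_ge[of "pi * p * (2 * z + \<i>)"] by (simp add: algebra_simps)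
      finally show "sinh (2 * pi * R) \<le> norm (S z)" .
    qed (use that in auto)
    finally show ?thesis by (simp add: B_def)
  qed
  have "(B \<longlongrightarrow> 0) at_top"
    unfolding B_def sinh_field_def by real_asymp
  define L where "L = \<i> / (2 * of_real p) * - (\<Sum>k\<in>K. c k)"
  have "finite K"
  proof (rule finite_subset)
    show "K \<subseteq> {- \<lceil>p\<rceil>..\<lceil>p\<rceil>}" by (auto simp: K_def; linarith)
  qed simp
  have inj: "inj_on pt K" using p by (auto simp: inj_on_def pt_def)
  have L_eq: "pi * \<i> * (\<Sum>z\<in>pt ` K. residue h z) = - L"
    using p by (simp add: sum.reindex[OF inj] res L_def flip: sum_divide_distrib)
  have est: "norm (integral {-R..R} (\<lambda>x. h (of_real x)) - L) \<le> B R" if "R \<ge> max R0 1" for R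
  proof -
    have "norm (integral {-R..R} (\<lambda>x. h (of_real x)) + pi * \<i> * (\<Sum>z\<in>pt ` K. residue h z)) \<le> B R"
    proof (rule integral_odd_about_strip_centre)
      show "\<bar>Re z\<bar> < R \<and> -1 < Im z \<and> Im z < 0" if "z \<in> pt ` K" for z
        using that \<open>R \<ge> max R0 1\<close> p by (auto simp: Re_pt Im_pt K_def field_simps)
      show "isolated_singularity_at h z" if "z \<in> pt ` K" for z
        unfolding h_def using that pt_strip by (auto intro!: isolated_singularity_at_remove_sings f_iso simp: K_def)
    qed (use h_odd h_ana bound that \<open>finite K\<close> in auto)
    then show ?thesis by (simp add: L_eq)
  qed
  have "((\<lambda>R. integral {-R..R} (\<lambda>x. h (of_real x)) - L) \<longlongrightarrow> 0) at_top"
    by (rule Lim_null_comparison[OF _ \<open>(B \<longlongrightarrow> 0) at_top\<close>])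
       (intro eventually_at_top_linorderI[of "max R0 1"] est)
  then have lim: "((\<lambda>R. integral {-R..R} (\<lambda>x. h (of_real x))) \<longlongrightarrow> L) at_top"
    by (simp add: LIM_zero_iff)
  have "isCont (\<lambda>x::real. h (of_real x)) x" for x
  proof (rule isCont_o2[where f = of_real and g = h])
    have "of_real x \<notin> pt ` K"
    proof
      assume "of_real x \<in> pt ` K"
      then obtain k where "k \<in> K" "Im (pt k) = 0" by (metis Im_complex_of_real imageE)
      then show False using p by (simp add: Im_pt K_def)
    qed
    then show "isCont h (of_real x)"
      by (intro analytic_at_imp_isCont h_ana) (simp_all add: strip_def)
  qed simp
  then have "(\<lambda>x::real. h (of_real x)) integrable_on {-R..R}" for R
    by (intro integrable_continuous_real continuous_at_imp_continuous_on ballI)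
  then show ?thesis
    using lim unfolding has_symmetric_integral_def sum_eq L_def h_def f_def by blast
qed

end
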